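(* Let $I$ be an image, let $p\in\mathbb{R}^2$ be an interest point, and let $h\in G$. Let $d$ be the GIFT descriptor of $p$ in $I$, and let $d'$ be the GIFT descriptor of the corresponding point $T_h(p)$ in the transformed image $T_h\circ I$. Then $d'=d$.
   Context: $G$ is the group of planar transformations generated by rotations about a fixed origin and (positive, uniform) scalings about that origin, with composition as group law, regarded as a locally compact group (isomorphic to $SO(2)\times\mathbb{R}_{>0}$). For $g\in G$, $T_g:\mathbb{R}^2\to\mathbb{R}^2$ denotes the corresponding transformation of the plane, so $T_g\circ T_h=T_{gh}$. An image is a function $I:\mathbb{R}^2\to\mathbb{R}^c$ (for a fixed $c$), and the transformed image is $(T_g\circ I)(x)=I(T_g^{-1}(x))$. A group feature is a map $G\to\mathbb{R}^n$. The GIFT descriptor of a point $p$ in an image $I$ is defined in three steps. 1. Group feature extraction. $\eta$ is a fixed map (computed by a convolutional neural network, treated as an arbitrary function) sending each image to a feature map $\mathbb{Z}^2\to\mathbb{R}^{n_0}$, and for a feature map $F$ and $q\in\mathbb{R}^2$, $\phi(F,q)\in\mathbb{R}^{n_0}$ is the value at $q$ of the bilinear interpolation of $F$. The initial group feature is $f_0:G\to\mathbb{R}^{n_0}$, $f_0(g)=\phi(\eta(T_g\circ I),T_g(p))$. 2. Group CNNs. Two group CNNs $\alpha$ and $\beta$, each consisting of $l\ge 1$ group convolution layers, are applied to $f_0$, giving outputs $f_{l,\alpha}:G\to\mathbb{R}^{n_\alpha}$ and $f_{l,\beta}:G\to\mathbb{R}^{n_\beta}$. A group convolution layer takes a group feature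 $u:G\to\mathbb{R}^{n}$ to the group feature $v:G\to\mathbb{R}^{m}$ given by $$[v(g)]_i=\sigma\left(\sum_{k\in H}u(kg)^{T}W_i(k)+b_i\right),\quad 1\le i\le m,\ g\in G,$$ where $H\subset G$ is a finite subset, $W_i:H\to\mathbb{R}^n$ are weights, $b_i\in\mathbb{R}$ are biases and $\sigma:\mathbb{R}\to\mathbb{R}$ is the activation function. Here $[\cdot]_i$ denotes the $i$-th coordinate. All layer parameters (which may differ between layers and between $\alpha$ and $\beta$) are fixed independently of $I$ and $p$. 3. Group bilinear pooling. The descriptor $d\in\mathbb{R}^{n_\alpha\times n_\beta}$ has entries $$d_{i,j}=\int_G [f_{l,\alpha}(g)]_i\,[f_{l,\beta}(g)]_j\,dg,$$ where $dg$ is a Haar measure on $G$; the integrals defining the descriptor $d$ of $p$ in $I$ are assumed to exist. *)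

theory Defs
  imports
    "HOL-Analysis.Analysis"
    "HOL-Algebra.Bij"
    "HOL-Algebra.Generated_Groups"
    "Jordan_Normal_Form.Matrix"
begin

text \<open>The operator \<open>$\<close> below is component access (from 0) in the variable-dimension vectors of
  \<^theory>\<open>Jordan_Normal_Form.Matrix\<close>; points of the plane use \<^const>\<open>vec_nth\<close>. Vectors of
  type \<open>real Matrix.vec\<close> are used for \<open>\<real>\<^sup>n\<close> because the dimension varies from layer to layer.\<close>

unbundle no vec_syntax

type_synonym plane = "(real, 2) Finite_Cartesian_Product.vec"
type_synonym 'c image = "plane \<Rightarrow> (real, 'c) Finite_Cartesian_Product.vec"
type_synonym feature_map = "int \<times> int \<Rightarrow> real Matrix.vec"
type_synonym group_feature = "(plane \<Rightarrow> plane) \<Rightarrow> real Matrix.vec"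


subsection \<open>The transformation group\<close>

definition rotations_about :: "plane \<Rightarrow> (plane \<Rightarrow> plane) set" where
  "rotations_about c = {\<lambda>x. c + Q *v (x - c) | Q. rotation_matrix Q}"

definition scalings_about :: "plane \<Rightarrow> (plane \<Rightarrow> plane) set" where
  "scalings_about c = {\<lambda>x. c + s *\<^sub>R (x - c) | s. s > 0}"

text \<open>Group elements are the transformations themselves, so \<open>T\<^sub>g\<close> is just \<open>g\<close>. The topology is the
  one the elements inherit from the function space \<^typ>\<open>plane \<Rightarrow> plane\<close>, i.e. pointwise
  convergence; for maps \<open>x \<mapsto> c + s Q (x - c)\<close> this is convergence of \<open>s\<close> and of
  \<open>Q\<close>, hence the topology of \<open>SO(2) \<times> \<real>\<^sub>>\<^sub>0\<close>.\<close>

definition rot_scale_group :: "plane \<Rightarrow> (plane \<Rightarrow> plane) monoid" where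
  "rot_scale_group c =
     subgroup_generated (BijGroup UNIV) (rotations_about c \<union> scalings_about c)"

lemma generators_in_BijGroup:
  "rotations_about c \<union> scalings_about c \<subseteq> carrier (BijGroup UNIV)"
proof -
  have "bij (\<lambda>x. c + Q *v (x - c))" if "rotation_matrix Q" for Q :: "real^2^2"
  proof (rule o_bij[where g = "\<lambda>y. c + transpose Q *v (y - c)"])
    have "transpose Q ** Q = Finite_Cartesian_Product.mat 1" "Q ** transpose Q = Finite_Cartesian_Product.mat 1"
      using that by (auto simp: rotation_matrix_def orthogonal_matrix_def)
    then show "(\<lambda>y. c + transpose Q *v (y - c)) \<circ> (\<lambda>x. c + Q *v (x - c)) = id"
      "(\<lambda>x. c + Q *v (x - c)) \<circ> (\<lambda>y. c + transpose Q *v (y - c)) = id"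
      by (auto simp: fun_eq_iff matrix_vector_mul_assoc simp del: transpose_matrix_vector)
  qed
  moreover have "bij (\<lambda>x. c + s *\<^sub>R (x - c))" if "s > 0" for s :: real
    using that by (intro o_bij[where g = "\<lambda>y. c + (1 / s) *\<^sub>R (y - c)"]) (auto simp: fun_eq_iff)
  ultimately show ?thesis
    by (auto simp: BijGroup_def Bij_def rotations_about_def scalings_about_def)
qed

lemma group_rot_scale_group: "group (rot_scale_group c)"
  unfolding rot_scale_group_def by (intro group.group_subgroup_generated group_BijGroup)

lemma carrier_rot_scale_group:
  "carrier (rot_scale_group c) =
     generate (BijGroup UNIV) (rotations_about c \<union> scalings_about c)"
  using generators_in_BijGroup[of c]
  by (simp add: rot_scale_group_def carrier_subgroup_generated Int_absorb1)

lemma mult_rot_scale_group: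
  assumes "g \<in> carrier (rot_scale_group c)" "h \<in> carrier (rot_scale_group c)"
  shows "g \<otimes>\<^bsub>rot_scale_group c\<^esub> h = g \<circ> h"
proof -
  have "carrier (rot_scale_group c) \<subseteq> carrier (BijGroup UNIV)"
    unfolding carrier_rot_scale_group
    by (intro group.generate_incl group_BijGroup generators_in_BijGroup)
  with assms show ?thesis
    by (auto simp: rot_scale_group_def subgroup_generated_def BijGroup_def compose_def)
qed


subsection \<open>Haar measures\<close>

text \<open>Nonzero left-invariant Radon measures on a group whose carrier has the subspace topology.\<close>

definition haar_measure :: "('a::topological_space, 'b) monoid_scheme \<Rightarrow> 'a measure \<Rightarrow> bool" where
  "haar_measure G M \<longleftrightarrow>
     space M = carrier G \<and>
     sets M = sets (restrict_space borel (carrier G)) \<and>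
     emeasure M (carrier G) \<noteq> 0 \<and>
     (\<forall>g\<in>carrier G. \<forall>A\<in>sets M. emeasure M ((\<lambda>x. g \<otimes>\<^bsub>G\<^esub> x) ` A) = emeasure M A) \<and>
     (\<forall>K. compact K \<and> K \<subseteq> carrier G \<longrightarrow> emeasure M K < \<infinity>) \<and>
     (\<forall>A\<in>sets M. emeasure M A =
        (INF U\<in>{U. openin (top_of_set (carrier G)) U \<and> A \<subseteq> U}. emeasure M U)) \<and>
     (\<forall>U. openin (top_of_set (carrier G)) U \<longrightarrow>
        emeasure M U = (SUP K\<in>{K. compact K \<and> K \<subseteq> U}. emeasure M K))"


subsection \<open>Group feature extraction\<close>

definition transform_image :: "(plane \<Rightarrow> plane) \<Rightarrow> 'c image \<Rightarrow> 'c image" where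
  "transform_image g I = (\<lambda>x. I (inv_into UNIV g x))"

definition bilinear_interpolation :: "feature_map \<Rightarrow> plane \<Rightarrow> real Matrix.vec" where
  "bilinear_interpolation F q =
     (let i = \<lfloor>vec_nth q 1\<rfloor>; j = \<lfloor>vec_nth q 2\<rfloor>; a = frac (vec_nth q 1); b = frac (vec_nth q 2)
      in ((1 - a) * (1 - b)) \<cdot>\<^sub>v F (i, j) + (a * (1 - b)) \<cdot>\<^sub>v F (i + 1, j)
         + ((1 - a) * b) \<cdot>\<^sub>v F (i, j + 1) + (a * b) \<cdot>\<^sub>v F (i + 1, j + 1))"

definition initial_feature :: "('c image \<Rightarrow> feature_map) \<Rightarrow> 'c image \<Rightarrow> plane \<Rightarrow> group_feature" where
  "initial_feature \<eta> I p = (\<lambda>g. bilinear_interpolation (\<eta> (transform_image g I)) (g p))"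


subsection \<open>Group CNNs\<close>

record gconv_layer =
  out_dim :: nat
  window :: "(plane \<Rightarrow> plane) set"
  weight :: "nat \<Rightarrow> (plane \<Rightarrow> plane) \<Rightarrow> real Matrix.vec"
  bias :: "nat \<Rightarrow> real"
  activation :: "real \<Rightarrow> real"

definition gconv ::
    "(plane \<Rightarrow> plane) monoid \<Rightarrow> gconv_layer \<Rightarrow> group_feature \<Rightarrow> group_feature" where
  "gconv G L u = (\<lambda>g. Matrix.vec (out_dim L) (\<lambda>i.
     activation L ((\<Sum>k\<in>window L. scalar_prod (u (k \<otimes>\<^bsub>G\<^esub> g)) (weight L i k)) + bias L i)))"

text \<open>A list of layers (first layer at the head) maps features with values in \<open>\<real>\<^sup>n\<close> to features
  with values in \<open>\<real>\<^sup>m\<close>.\<close>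

fun group_cnn :: "(plane \<Rightarrow> plane) monoid \<Rightarrow> nat \<Rightarrow> gconv_layer list \<Rightarrow> nat \<Rightarrow> bool" where
  "group_cnn G n [] m \<longleftrightarrow> n = m"
| "group_cnn G n (L # Ls) m \<longleftrightarrow>
     finite (window L) \<and> window L \<subseteq> carrier G \<and>
     (\<forall>i<out_dim L. \<forall>k\<in>window L. weight L i k \<in> carrier_vec n) \<and>
     group_cnn G (out_dim L) Ls m"

definition apply_group_cnn ::
    "(plane \<Rightarrow> plane) monoid \<Rightarrow> gconv_layer list \<Rightarrow> group_feature \<Rightarrow> group_feature" where
  "apply_group_cnn G Ls u = fold (gconv G) Ls u"


subsection \<open>Group bilinear pooling and the descriptor\<close>

definition pooling_integrable ::
    "(plane \<Rightarrow> plane) measure \<Rightarrow> nat \<Rightarrow> nat \<Rightarrow> group_feature \<Rightarrow> group_feature \<Rightarrow> bool" where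
  "pooling_integrable M m n u v \<longleftrightarrow>
     (\<forall>i<m. \<forall>j<n. integrable M (\<lambda>g. (u g $ i) * (v g $ j)))"

definition bilinear_pooling ::
    "(plane \<Rightarrow> plane) measure \<Rightarrow> nat \<Rightarrow> nat \<Rightarrow> group_feature \<Rightarrow> group_feature \<Rightarrow> real Matrix.mat" where
  "bilinear_pooling M m n u v =
     Matrix.mat m n (\<lambda>(i, j). \<integral>g. (u g $ i) * (v g $ j) \<partial>M)"

text \<open>Since the Bochner integral is total, existence of the integrals is a separate predicate.\<close>

definition gift_descriptor_exists where
  "gift_descriptor_exists G M \<eta> \<alpha> \<beta> n\<^sub>\<alpha> n\<^sub>\<beta> I p \<longleftrightarrow>
     pooling_integrable M n\<^sub>\<alpha> n\<^sub>\<beta>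
       (apply_group_cnn G \<alpha> (initial_feature \<eta> I p)) (apply_group_cnn G \<beta> (initial_feature \<eta> I p))"

definition gift_descriptor where
  "gift_descriptor G M \<eta> \<alpha> \<beta> n\<^sub>\<alpha> n\<^sub>\<beta> I p =
     bilinear_pooling M n\<^sub>\<alpha> n\<^sub>\<beta>
       (apply_group_cnn G \<alpha> (initial_feature \<eta> I p)) (apply_group_cnn G \<beta> (initial_feature \<eta> I p))"

end

theory Submission
  imports Defs
begin

text \<open>The transformed pair satisfies \<open>f\<^sub>0'(g) = f\<^sub>0(g h)\<close>. Since a layer evaluates its input at the left
  translates \<open>k g\<close>, it commutes with the right translation by \<open>h\<close>, so both network outputs are merely
  right-translated by \<open>h\<close>. In coordinates centred at \<open>c\<close> every group element is multiplication by a
  nonzero complex number; hence the group is commutative, the right translation is a left translation,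
  and the pooling integral absorbs it.\<close>

section \<open>Complex multiplication in coordinates centred at \<open>c\<close>\<close>

text \<open>Multiplication by the imaginary unit, with the plane read as the complex
  numbers.\<close>

definition quarter_turn :: "plane \<Rightarrow> plane" where
  "quarter_turn v = vector [- vec_nth v 2, vec_nth v 1]"

text \<open>Multiplication by the complex number with real part \<open>a\<close> and imaginary part
  \<open>b\<close>, centred at \<open>c\<close>. Zero is allowed, so the composition law needs no
  side condition.\<close>

definition similarity :: "plane \<Rightarrow> real \<Rightarrow> real \<Rightarrow> plane \<Rightarrow> plane" where
  "similarity c a b x = c + a *\<^sub>R (x - c) + b *\<^sub>R quarter_turn (x - c)"

lemma similarity_nth:
  "vec_nth (similarity c a b x) 1 =
     vec_nth c 1 + a * (vec_nth x 1 - vec_nth c 1) - b * (vec_nth x 2 - vec_nth c 2)"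
  "vec_nth (similarity c a b x) 2 =
     vec_nth c 2 + a * (vec_nth x 2 - vec_nth c 2) + b * (vec_nth x 1 - vec_nth c 1)"
  by (simp_all add: similarity_def quarter_turn_def algebra_simps)

lemma plane_eqI: "vec_nth x 1 = vec_nth y 1 \<Longrightarrow> vec_nth x 2 = vec_nth y 2 \<Longrightarrow> x = y"
  for x y :: plane
  by (simp add: Finite_Cartesian_Product.vec_eq_iff forall_2)

text \<open>The new coefficients are those of the complex product; their symmetry in the two factors
  later yields commutativity.\<close>

lemma similarity_comp:
  "similarity c a b \<circ> similarity c a' b' = similarity c (a * a' - b * b') (a * b' + b * a')"
  by (intro ext plane_eqI) (simp_all add: similarity_nth algebra_simps)

lemma similarity_one: "similarity c 1 0 = id"
  by (simp add: similarity_def fun_eq_iff)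

lemma continuous_on_similarity: "continuous_on A (similarity c a b)"
proof -
  have "continuous_on A (\<lambda>x. vec_nth (similarity c a b x) i)" for i
    using exhaust_2[of i]
    by (elim disjE) (simp_all only: similarity_nth, intro continuous_intros, intro continuous_intros)
  then have "continuous_on A (\<lambda>x. vec_lambda (\<lambda>i. vec_nth (similarity c a b x) i))"
    by (rule continuous_on_vec_lambda)
  then show ?thesis by simp
qed

text \<open>The reciprocal of a nonzero complex number is its conjugate divided by its squared
  modulus.\<close>

lemma inv_similarity:
  assumes "a\<^sup>2 + b\<^sup>2 \<noteq> 0"
  shows "inv_into UNIV (similarity c a b) = similarity c (a / (a\<^sup>2 + b\<^sup>2)) (- b / (a\<^sup>2 + b\<^sup>2))"
proof (rule inv_unique_comp)
  have "a * (a / (a\<^sup>2 + b\<^sup>2)) + b * (b / (a\<^sup>2 + b\<^sup>2)) = 1"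
    using assms by (simp add: power2_eq_square add_divide_distrib[symmetric])
  then show "similarity c a b \<circ> similarity c (a / (a\<^sup>2 + b\<^sup>2)) (- b / (a\<^sup>2 + b\<^sup>2)) = id"
    "similarity c (a / (a\<^sup>2 + b\<^sup>2)) (- b / (a\<^sup>2 + b\<^sup>2)) \<circ> similarity c a b = id"
    by (simp_all add: similarity_comp similarity_one[of c, symmetric] mult.commute)
qed

section \<open>The group consists of similarities\<close>

lemma rotation_matrix_2_entries:
  fixes Q :: "real^2^2"
  assumes "rotation_matrix Q"
  shows "vec_nth (vec_nth Q 2) 2 = vec_nth (vec_nth Q 1) 1"
    and "vec_nth (vec_nth Q 1) 2 = - vec_nth (vec_nth Q 2) 1"
    and "(vec_nth (vec_nth Q 1) 1)\<^sup>2 + (vec_nth (vec_nth Q 2) 1)\<^sup>2 = 1"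
proof -
  define q where "q i j = vec_nth (vec_nth Q i) j" for i j
  have "transpose Q ** Q = Finite_Cartesian_Product.mat 1" "det Q = 1"
    using assms by (auto simp: rotation_matrix_def orthogonal_matrix_def)
  then have eqs: "q 1 1 * q 1 1 + q 2 1 * q 2 1 = 1" "q 1 2 * q 1 2 + q 2 2 * q 2 2 = 1"
    "q 1 1 * q 2 2 - q 1 2 * q 2 1 = 1"
    by (auto simp: q_def Finite_Cartesian_Product.vec_eq_iff matrix_matrix_mult_def
        transpose_def sum_2 forall_2 Finite_Cartesian_Product.mat_def det_2)
  \<comment> \<open>Expanded, the left side is the sum of the squared lengths of the two columns
    minus twice the determinant: 1 + 1 - 2.\<close>
  then have "(q 1 1 - q 2 2)\<^sup>2 + (q 1 2 + q 2 1)\<^sup>2 = 0"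
    by (simp add: power2_eq_square algebra_simps)
  then have "q 2 2 = q 1 1" "q 1 2 = - q 2 1"
    by (simp_all add: sum_power2_eq_zero_iff)
  with eqs show "vec_nth (vec_nth Q 2) 2 = vec_nth (vec_nth Q 1) 1"
    "vec_nth (vec_nth Q 1) 2 = - vec_nth (vec_nth Q 2) 1"
    "(vec_nth (vec_nth Q 1) 1)\<^sup>2 + (vec_nth (vec_nth Q 2) 1)\<^sup>2 = 1"
    by (auto simp: q_def power2_eq_square)
qed

text \<open>A rotation is determined by its first column, a scaling by a real factor. The nonzero
  modulus is recorded because inverses of generators are needed.\<close>

lemma generator_eq_similarity:
  assumes "g \<in> rotations_about c \<union> scalings_about c"
  obtains a b where "a\<^sup>2 + b\<^sup>2 \<noteq> 0" "g = similarity c a b"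
  using assms
proof
  assume "g \<in> rotations_about c"
  then obtain Q where Q: "rotation_matrix Q" and g: "g = (\<lambda>x. c + Q *v (x - c))"
    by (auto simp: rotations_about_def)
  note entries = rotation_matrix_2_entries[OF Q]
  have "g = similarity c (vec_nth (vec_nth Q 1) 1) (vec_nth (vec_nth Q 2) 1)"
    by (intro ext plane_eqI)
      (simp_all add: g similarity_nth matrix_vector_mult_def sum_2 entries algebra_simps)
  with entries(3) show thesis
    by (intro that) auto
next
  assume "g \<in> scalings_about c"
  then obtain s where "s > 0" "g = (\<lambda>x. c + s *\<^sub>R (x - c))"
    by (auto simp: scalings_about_def)
  then show thesis
    by (intro that[of s 0]) (auto simp: similarity_def fun_eq_iff)
qed

text \<open>In \<open>generate\<close>, inverses are taken of generators only, so the induction can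
  forget that the modulus is nonzero.\<close>

lemma rot_scale_group_eq_similarity:
  assumes "g \<in> carrier (rot_scale_group c)"
  obtains a b where "g = similarity c a b"
proof -
  let ?gens = "rotations_about c \<union> scalings_about c"
  note gen = assms[unfolded carrier_rot_scale_group]
  have sub: "generate (BijGroup UNIV) ?gens \<subseteq> Bij UNIV"
    using group.generate_incl[OF group_BijGroup generators_in_BijGroup[of c]]
    by (simp add: BijGroup_def)
  from gen have "\<exists>a b. g = similarity c a b"
  proof (induction rule: generate.induct)
    case one
    then show ?case
      by (auto simp: BijGroup_def similarity_one[of c, symmetric] restrict_def simp flip: id_def)
  next
    case (incl g)
    then show ?case
      by (metis generator_eq_similarity)
  next
    case (inv g)
    from inv obtain a b where "a\<^sup>2 + b\<^sup>2 \<noteq> 0" "g = similarity c a b"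
      by (rule generator_eq_similarity)
    moreover have "g \<in> Bij UNIV"
      using inv generators_in_BijGroup[of c] by (auto simp: BijGroup_def)
    ultimately show ?case
      by (auto simp: inv_BijGroup restrict_def inv_similarity)
  next
    case (eng g h)
    then have "g \<otimes>\<^bsub>BijGroup UNIV\<^esub> h = g \<circ> h"
      using sub by (auto simp: BijGroup_def compose_def)
    with eng.IH show ?case
      by (metis similarity_comp)
  qed
  with that show thesis
    by blast
qed

lemma rot_scale_group_comm:
  assumes "g \<in> carrier (rot_scale_group c)" "h \<in> carrier (rot_scale_group c)"
  shows "g \<otimes>\<^bsub>rot_scale_group c\<^esub> h = h \<otimes>\<^bsub>rot_scale_group c\<^esub> g"
proof -
  obtain a b a' b' where "g = similarity c a b" "h = similarity c a' b'"
    by (metis assms rot_scale_group_eq_similarity)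
  then have "g \<circ> h = h \<circ> g"
    by (simp add: similarity_comp algebra_simps)
  then show ?thesis
    by (simp add: mult_rot_scale_group assms)
qed

text \<open>The topology is pointwise convergence, so it suffices that \<open>h (g x)\<close>
  depends continuously on \<open>g x\<close> for each fixed \<open>x\<close>, which is continuity of
  the similarity \<open>h\<close> on the plane.\<close>

lemma continuous_on_left_translation:
  assumes "h \<in> carrier (rot_scale_group c)"
  shows "continuous_on (carrier (rot_scale_group c)) (\<lambda>g. h \<otimes>\<^bsub>rot_scale_group c\<^esub> g)"
proof -
  obtain a b where h: "h = similarity c a b"
    using assms by (rule rot_scale_group_eq_similarity)
  have "continuous_on UNIV (\<lambda>g :: plane \<Rightarrow> plane. h \<circ> g)"
    unfolding h
    by (intro continuous_on_coordinatewise_then_product)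
      (auto intro!: continuous_on_compose2[OF continuous_on_similarity[of UNIV]]
        continuous_on_product_coordinates)
  then have "continuous_on (carrier (rot_scale_group c)) (\<lambda>g. h \<circ> g)"
    by (rule continuous_on_subset) simp
  then show ?thesis
    by (simp add: mult_rot_scale_group assms cong: continuous_on_cong)
qed

lemma bij_rot_scale_group:
  assumes "g \<in> carrier (rot_scale_group c)"
  shows "bij g"
  using assms group.generate_incl[OF group_BijGroup generators_in_BijGroup[of c]]
  by (auto simp: carrier_rot_scale_group BijGroup_def Bij_def)

section \<open>Left translation and the Haar measure\<close>

text \<open>\<open>M\<close> lives on the Borel sets of the carrier, so continuity suffices. It is
  assumed because \<open>G\<close> is only an abstract group here.\<close>

lemma measurable_left_translation:
  assumes "group G" "haar_measure G M" "h \<in> carrier G"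
    and "continuous_on (carrier G) (\<lambda>g. h \<otimes>\<^bsub>G\<^esub> g)"
  shows "(\<lambda>g. h \<otimes>\<^bsub>G\<^esub> g) \<in> M \<rightarrow>\<^sub>M M"
proof -
  interpret group G by fact
  have sets: "sets M = sets (restrict_space borel (carrier G))"
    using assms(2) by (simp add: haar_measure_def)
  have "(\<lambda>g. h \<otimes>\<^bsub>G\<^esub> g) \<in> restrict_space borel (carrier G) \<rightarrow>\<^sub>M restrict_space borel (carrier G)"
    using assms(3,4)
    by (intro measurable_restrict_space2 borel_measurable_continuous_on_restrict)
      (auto simp: space_restrict_space)
  then show ?thesis
    using measurable_cong_sets[OF sets sets] by simp
qed

lemma distr_left_translation:
  assumes "group G" "haar_measure G M" "h \<in> carrier G"
    and "continuous_on (carrier G) (\<lambda>g. h \<otimes>\<^bsub>G\<^esub> g)"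
  shows "distr M M (\<lambda>g. h \<otimes>\<^bsub>G\<^esub> g) = M"
proof (rule measure_eqI)
  interpret group G by fact
  fix A assume "A \<in> sets (distr M M (\<lambda>g. h \<otimes>\<^bsub>G\<^esub> g))"
  then have A: "A \<in> sets M" by simp
  have left_invariant: "\<forall>g\<in>carrier G. \<forall>A\<in>sets M.
      emeasure M ((\<lambda>x. g \<otimes>\<^bsub>G\<^esub> x) ` A) = emeasure M A"
    using assms(2) unfolding haar_measure_def by (elim conjE)
  have space: "space M = carrier G"
    using assms(2) by (simp add: haar_measure_def)
  have sub: "A \<subseteq> carrier G"
    using sets.sets_into_space[OF A] space by simp
  \<comment> \<open>A push-forward measures preimages, whereas \<open>haar_measure\<close> states
    invariance for images; the preimage under \<open>h\<close> is the image under its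
    inverse.\<close>
  have "(\<lambda>g. h \<otimes>\<^bsub>G\<^esub> g) -` A \<inter> space M = (\<lambda>g. inv\<^bsub>G\<^esub> h \<otimes>\<^bsub>G\<^esub> g) ` A"
  proof safe
    fix g assume "g \<in> space M" "h \<otimes>\<^bsub>G\<^esub> g \<in> A"
    then show "g \<in> (\<lambda>g. inv\<^bsub>G\<^esub> h \<otimes>\<^bsub>G\<^esub> g) ` A"
      using assms(3) space by (intro image_eqI[of _ _ "h \<otimes>\<^bsub>G\<^esub> g"]) (auto simp: m_assoc[symmetric])
  qed (use sub assms(3) space in \<open>auto simp: m_assoc[symmetric]\<close>)
  then have "emeasure (distr M M (\<lambda>g. h \<otimes>\<^bsub>G\<^esub> g)) A =
      emeasure M ((\<lambda>g. inv\<^bsub>G\<^esub> h \<otimes>\<^bsub>G\<^esub> g) ` A)"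
    by (simp only: emeasure_distr[OF measurable_left_translation[OF assms] A])
  also have "\<dots> = emeasure M A"
    by (rule left_invariant[rule_format, OF inv_closed[OF assms(3)] A])
  finally show "emeasure (distr M M (\<lambda>g. h \<otimes>\<^bsub>G\<^esub> g)) A = emeasure M A" .
qed simp

lemma
  fixes f :: "_ \<Rightarrow> 'b::{banach, second_countable_topology}"
  assumes "group G" "haar_measure G M" "h \<in> carrier G"
    and "continuous_on (carrier G) (\<lambda>g. h \<otimes>\<^bsub>G\<^esub> g)" and f: "integrable M f"
  shows integrable_left_translation: "integrable M (\<lambda>g. f (h \<otimes>\<^bsub>G\<^esub> g))"
    and integral_left_translation: "(\<integral>g. f (h \<otimes>\<^bsub>G\<^esub> g) \<partial>M) = (\<integral>g. f g \<partial>M)"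
proof -
  note T = measurable_left_translation[OF assms(1-4)]
    and M = distr_left_translation[OF assms(1-4)]
  show "integrable M (\<lambda>g. f (h \<otimes>\<^bsub>G\<^esub> g))"
    using f by (intro integrable_distr[OF T]) (simp add: M)
  show "(\<integral>g. f (h \<otimes>\<^bsub>G\<^esub> g) \<partial>M) = (\<integral>g. f g \<partial>M)"
    using integral_distr[OF T borel_measurable_integrable[OF f]] by (simp add: M)
qed

section \<open>Equivariance of the features\<close>

text \<open>Image and point change together: inverting \<open>g \<circ> h\<close> reverses the
  order, so transforming by \<open>h\<close> and then \<open>g\<close> is transforming by the
  product, and \<open>g (h p)\<close> is the product applied to \<open>p\<close>.\<close>

lemma initial_feature_transform:
  assumes "g \<in> carrier (rot_scale_group c)" "h \<in> carrier (rot_scale_group c)"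
  shows "initial_feature \<eta> (transform_image h I) (h p) g =
    initial_feature \<eta> I p (g \<otimes>\<^bsub>rot_scale_group c\<^esub> h)"
  using assms
  by (simp add: initial_feature_def transform_image_def mult_rot_scale_group o_inv_distrib
      bij_rot_scale_group)

text \<open>The window element multiplies on the left and \<open>h\<close> on the right, so
  associativity lets them pass each other. The window must lie in the carrier, where
  \<open>u'\<close> is known.\<close>

lemma gconv_right_translation:
  assumes "group G" "h \<in> carrier G" "g \<in> carrier G" "window L \<subseteq> carrier G"
    and "\<And>x. x \<in> carrier G \<Longrightarrow> u' x = u (x \<otimes>\<^bsub>G\<^esub> h)"
  shows "gconv G L u' g = gconv G L u (g \<otimes>\<^bsub>G\<^esub> h)"
proof -
  interpret group G by fact
  have "u' (k \<otimes>\<^bsub>G\<^esub> g) = u (k \<otimes>\<^bsub>G\<^esub> (g \<otimes>\<^bsub>G\<^esub> h))" if "k \<in> window L" for k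
    using assms(2-5) that by (simp add: subset_iff m_assoc)
  then show ?thesis
    by (simp add: gconv_def)
qed

lemma apply_group_cnn_right_translation:
  assumes "group G" "h \<in> carrier G" "g \<in> carrier G" "group_cnn G n Ls m"
    and "\<And>x. x \<in> carrier G \<Longrightarrow> u' x = u (x \<otimes>\<^bsub>G\<^esub> h)"
  shows "apply_group_cnn G Ls u' g = apply_group_cnn G Ls u (g \<otimes>\<^bsub>G\<^esub> h)"
  using assms(4,5)
\<comment> \<open>The input features and dimension vary, since the remaining layers receive the
  output of the first one.\<close>
proof (induction Ls arbitrary: n u u')
  case Nil
  then show ?case
    using assms(3) by (simp add: apply_group_cnn_def)
next
  case (Cons L Ls)
  then have "gconv G L u' x = gconv G L u (x \<otimes>\<^bsub>G\<^esub> h)" if "x \<in> carrier G" for x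
    using that assms(1,2) by (intro gconv_right_translation) auto
  with Cons.prems(1) Cons.IH[of "out_dim L" "gconv G L u'" "gconv G L u"] show ?case
    by (simp add: apply_group_cnn_def)
qed

theorem proposition1:
  fixes c p :: plane
    and I :: "'c::finite image"
    and h :: "plane \<Rightarrow> plane"
    and M :: "(plane \<Rightarrow> plane) measure"
    and \<eta> :: "'c image \<Rightarrow> feature_map"
    and \<alpha> \<beta> :: "gconv_layer list"
    and l n\<^sub>0 n\<^sub>\<alpha> n\<^sub>\<beta> :: nat
  assumes haar: "haar_measure (rot_scale_group c) M"
    and extractor: "\<And>J q. \<eta> J q \<in> carrier_vec n\<^sub>0"
    and depth: "l \<ge> 1" "length \<alpha> = l" "length \<beta> = l"
    and cnn_alpha: "group_cnn (rot_scale_group c) n\<^sub>0 \<alpha> n\<^sub>\<alpha>"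
    and cnn_beta: "group_cnn (rot_scale_group c) n\<^sub>0 \<beta> n\<^sub>\<beta>"
    and h: "h \<in> carrier (rot_scale_group c)"
    and integrals_exist: "gift_descriptor_exists (rot_scale_group c) M \<eta> \<alpha> \<beta> n\<^sub>\<alpha> n\<^sub>\<beta> I p"
  shows "gift_descriptor_exists (rot_scale_group c) M \<eta> \<alpha> \<beta> n\<^sub>\<alpha> n\<^sub>\<beta> (transform_image h I) (h p) \<and>
    gift_descriptor (rot_scale_group c) M \<eta> \<alpha> \<beta> n\<^sub>\<alpha> n\<^sub>\<beta> (transform_image h I) (h p) =
    gift_descriptor (rot_scale_group c) M \<eta> \<alpha> \<beta> n\<^sub>\<alpha> n\<^sub>\<beta> I p"
proof -
  let ?G = "rot_scale_group c"
  define f f' where "f Ls = apply_group_cnn ?G Ls (initial_feature \<eta> I p)"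
    and "f' Ls = apply_group_cnn ?G Ls (initial_feature \<eta> (transform_image h I) (h p))" for Ls
  \<comment> \<open>Equivariance gives a right translation; commutativity turns it into the left
    translation under which \<open>M\<close> is invariant.\<close>
  have translate: "f' Ls g = f Ls (h \<otimes>\<^bsub>?G\<^esub> g)" if "group_cnn ?G n\<^sub>0 Ls m" "g \<in> space M" for Ls m g
  proof -
    have g: "g \<in> carrier ?G"
      using that(2) haar by (simp add: haar_measure_def)
    have "f' Ls g = f Ls (g \<otimes>\<^bsub>?G\<^esub> h)"
      unfolding f_def f'_def
      using group_rot_scale_group h g that(1) initial_feature_transform[OF _ h]
      by (rule apply_group_cnn_right_translation)
    then show ?thesis
      by (simp only: rot_scale_group_comm[OF g h])
  qed
  \<comment> \<open>Both factors are translated by the same \<open>h\<close>, so the new integrand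
    is a translate of the old one as a whole, and integrability transfers with the value.\<close>
  have pooled: "integrable M (\<lambda>g. f' \<alpha> g $ i * f' \<beta> g $ j)
      \<and> (\<integral>g. f' \<alpha> g $ i * f' \<beta> g $ j \<partial>M) = (\<integral>g. f \<alpha> g $ i * f \<beta> g $ j \<partial>M)"
    if "i < n\<^sub>\<alpha>" "j < n\<^sub>\<beta>" for i j
  proof -
    have int: "integrable M (\<lambda>g. f \<alpha> g $ i * f \<beta> g $ j)"
      using integrals_exist that
      by (simp add: gift_descriptor_exists_def pooling_integrable_def f_def)
    have eq: "f' \<alpha> g $ i * f' \<beta> g $ j = f \<alpha> (h \<otimes>\<^bsub>?G\<^esub> g) $ i * f \<beta> (h \<otimes>\<^bsub>?G\<^esub> g) $ j"
      if "g \<in> space M" for g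
      using translate[OF cnn_alpha that] translate[OF cnn_beta that] by simp
    note trans = group_rot_scale_group haar h continuous_on_left_translation[OF h] int
    show ?thesis
      using integrable_left_translation[OF trans] integral_left_translation[OF trans]
      by (simp add: eq cong: Bochner_Integration.integrable_cong Bochner_Integration.integral_cong)
  qed
  then show ?thesis
    by (auto simp: gift_descriptor_exists_def pooling_integrable_def gift_descriptor_def
        bilinear_pooling_def f_def f'_def intro!: cong_mat)
qed

end
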